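(* Let $m,n\ge 1$ and let $A\in\mathbb{R}^{m\times n}$ be a column distinct matrix with principal order matrix $\bar A$. Then $\mathcal{I}(A,\omega)=\mathcal{I}(\bar A,\omega)$ for all $\omega\in(0,1]$.
   Context: Let $M=\{1,\ldots,m\}$, $N=\{1,\ldots,n\}$. For $\omega\in(0,1]$, $A\in\mathbb{R}^{m\times n}$ and $x\in\mathbb{R}^n$, $A\otimes_\omega x\in\mathbb{R}^m$ is the vector whose $i$-th entry is the $\lceil\omega n\rceil$-th smallest element (counted with multiplicity) of the multiset $\{A(i,j)+x_j : j\in N\}$. The normalized equation is $A\otimes_\omega x=\mathbf{0}$, with solution set $\mathcal{S}(A,\omega)=\{x\in\mathbb{R}^n : A\otimes_\omega x=\mathbf{0}\}$. For $x\in\mathcal{S}(A,\omega)$ put $\mathcal{I}(A,\omega,x)=\{(i_1,\ldots,i_n)\in M^n : A(i_k,k)+x_k=0\text{ for all }k\in N\}$, and define the set of solution indices $\mathcal{I}(A,\omega)=\bigcup_{x\in\mathcal{S}(A,\omega)}\mathcal{I}(A,\omega,x)$. $A$ is column distinct if, in each column of $A$, the entries are pairwise distinct. For column distinct $A$, the principal order matrix $\bar A$ is the $m\times n$ matrix with $\bar A(i,j)=k$ if $A(i,j)$ is the $k$-th smallest element of the column $A(\cdot,j)$. *)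

theory Defs
  imports "HOL-Analysis.Finite_Cartesian_Product" "HOL-Library.Multiset"
begin

text \<open>Matrices with rows indexed by a finite type \<open>'m\<close> and columns by a finite type \<open>'n\<close>
  have type \<open>real ^ 'n ^ 'm\<close>, so the entry A(i,j) is \<open>A $ i $ j\<close>.\<close>

text \<open>Ranks are counted from 1, with multiplicity; meaningful for \<open>1 \<le> k \<le> size S\<close>.\<close>

definition kth_smallest :: "nat \<Rightarrow> 'a::linorder multiset \<Rightarrow> 'a" where
  "kth_smallest k S = sorted_list_of_multiset S ! (k - 1)"

definition otimes :: "real \<Rightarrow> real ^ 'n ^ 'm \<Rightarrow> real ^ 'n \<Rightarrow> real ^ 'm" where
  "otimes \<omega> A x =
    (\<chi> i. kth_smallest (nat \<lceil>\<omega> * real CARD('n)\<rceil>) {# A $ i $ j + x $ j. j \<in># mset_set UNIV #})"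

definition solution_set :: "real ^ 'n ^ 'm \<Rightarrow> real \<Rightarrow> (real ^ 'n) set" where
  "solution_set A \<omega> = {x. otimes \<omega> A x = 0}"

definition solution_indices_at :: "real ^ 'n ^ 'm \<Rightarrow> real ^ 'n \<Rightarrow> ('m ^ 'n) set" where
  "solution_indices_at A x = {t. \<forall>k. A $ (t $ k) $ k + x $ k = 0}"

definition solution_indices :: "real ^ 'n ^ 'm \<Rightarrow> real \<Rightarrow> ('m ^ 'n) set" where
  "solution_indices A \<omega> = (\<Union>x \<in> solution_set A \<omega>. solution_indices_at A x)"

definition column_distinct :: "real ^ 'n ^ 'm \<Rightarrow> bool" where
  "column_distinct A \<longleftrightarrow> (\<forall>j. inj (\<lambda>i. A $ i $ j))"

text \<open>The rank is unique when \<open>A\<close> is column distinct; otherwise the description may be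
  unspecified. The ranks are embedded into the reals, so that the result is again a real matrix.\<close>

definition principal_order_matrix :: "real ^ 'n ^ 'm \<Rightarrow> real ^ 'n ^ 'm" where
  "principal_order_matrix A =
    (\<chi> i j. real (THE k. k \<in> {1..CARD('m)} \<and>
                       A $ i $ j = kth_smallest k {# A $ l $ j. l \<in># mset_set UNIV #}))"

end

theory Submission imports Defs begin

text \<open>The set of solution indices of a matrix depends only on the order of the entries within
  each column. A tuple \<open>t\<close> can only be a solution index through the single vector
  \<open>x\<^sub>k = - A(t\<^sub>k,k)\<close>, so it is one exactly when, for every row \<open>i\<close>, the \<open>\<lceil>\<omega>n\<rceil>\<close>-th smallest of
  the differences \<open>A(i,j) - A(t\<^sub>j,j)\<close> is zero. By \<open>kth_smallest_iff_le_size_filter\<close> this is a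
  statement about how many of these differences are negative and how many are nonpositive, and
  the sign of \<open>A(i,j) - A(t\<^sub>j,j)\<close> is a comparison between two entries of column \<open>j\<close>. Hence two
  matrices whose columns are ordered in the same way have the same solution indices
  (\<open>solution_indices_cong_order\<close>). Replacing the entries of a column without repetitions by their
  ranks keeps their order (\<open>principal_order_matrix_less_iff\<close>), which gives the theorem.\<close>

text \<open>In a sorted list, the elements that satisfy a downward closed property form a prefix.\<close>

lemma sorted_nth_iff_less_length_filter:
  assumes "sorted xs" "i < length xs"
    and down: "\<And>x y. x \<le> y \<Longrightarrow> P y \<Longrightarrow> P x"
  shows "P (xs ! i) \<longleftrightarrow> i < length (filter P xs)"
  using assms(1,2)
proof (induction xs arbitrary: i)
  case (Cons a xs)
  show ?case
  proof (cases "P a")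
    case True
    with Cons show ?thesis by (cases i) auto
  next
    case False
    with Cons.prems(1) down have none: "\<forall>y \<in> set (a # xs). \<not> P y"
      by auto
    then have "\<not> P ((a # xs) ! i)" using Cons.prems(2) nth_mem by blast
    moreover from none have "filter P (a # xs) = []" by (simp add: filter_empty_conv)
    ultimately show ?thesis by simp
  qed
qed simp

text \<open>This turns order statistics into counting: taking \<open>P\<close> to be \<open>\<lambda>x. x \<le> c\<close> and \<open>\<lambda>x. x < c\<close>
  locates the \<open>k\<close>-th smallest element relative to \<open>c\<close>.\<close>

lemma kth_smallest_iff_le_size_filter:
  assumes "1 \<le> k" "k \<le> size S"
    and down: "\<And>x y. x \<le> y \<Longrightarrow> P y \<Longrightarrow> P x"
  shows "P (kth_smallest k S) \<longleftrightarrow> k \<le> size (filter_mset P S)"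
proof -
  let ?xs = "sorted_list_of_multiset S"
  have S: "mset ?xs = S" by simp
  then have len: "length ?xs = size S" by (metis size_mset)
  have filt: "length (filter P ?xs) = size (filter_mset P S)"
    by (metis S mset_filter size_mset)
  have "P (?xs ! (k - 1)) \<longleftrightarrow> k - 1 < length (filter P ?xs)"
    using assms len by (intro sorted_nth_iff_less_length_filter) auto
  with filt assms(1) show ?thesis by (auto simp: kth_smallest_def)
qed

lemma kth_smallest_eq_iff:
  assumes "1 \<le> k" "k \<le> size S"
  shows "kth_smallest k S = c \<longleftrightarrow>
    size {#x \<in># S. x < c#} < k \<and> k \<le> size {#x \<in># S. x \<le> c#}"
  using kth_smallest_iff_le_size_filter[OF assms, of "\<lambda>x. x \<le> c"]
    kth_smallest_iff_le_size_filter[OF assms, of "\<lambda>x. x < c"]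
  by fastforce

text \<open>The requirement \<open>A(t\<^sub>k,k) + x\<^sub>k = 0\<close> determines \<open>x\<close> from \<open>t\<close>, which removes the
  quantification over solutions.\<close>

lemma mem_solution_indices_iff:
  "t \<in> solution_indices A \<omega> \<longleftrightarrow> otimes \<omega> A (\<chi> k. - A $ (t $ k) $ k) = 0"
proof -
  have "t \<in> solution_indices_at A x \<longleftrightarrow> x = (\<chi> k. - A $ (t $ k) $ k)" for x
    by (auto simp: solution_indices_at_def vec_eq_iff eq_neg_iff_add_eq_0 add.commute)
  then show ?thesis by (auto simp: solution_indices_def solution_set_def)
qed

lemma mem_solution_indices_iff_card:
  fixes A :: "real ^ 'n ^ 'm"
  assumes "0 < \<omega>" "\<omega> \<le> 1"
  shows "t \<in> solution_indices A \<omega> \<longleftrightarrow>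
    (\<forall>i. card {j. A $ i $ j < A $ (t $ j) $ j} < nat \<lceil>\<omega> * real CARD('n)\<rceil> \<and>
         nat \<lceil>\<omega> * real CARD('n)\<rceil> \<le> card {j. A $ i $ j \<le> A $ (t $ j) $ j})"
proof -
  define k where "k = nat \<lceil>\<omega> * real CARD('n)\<rceil>"
  have "0 < \<omega> * real CARD('n)" using assms by simp
  then have "1 \<le> k" unfolding k_def by linarith
  have "\<omega> * real CARD('n) \<le> real CARD('n)" using assms by (simp add: mult_left_le_one_le)
  then have "k \<le> CARD('n)" unfolding k_def by linarith
  have "kth_smallest k {# A $ i $ j - A $ (t $ j) $ j. j \<in># mset_set UNIV #} = 0 \<longleftrightarrow>
      card {j. A $ i $ j < A $ (t $ j) $ j} < k \<and> k \<le> card {j. A $ i $ j \<le> A $ (t $ j) $ j}" for i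
    using \<open>1 \<le> k\<close> \<open>k \<le> CARD('n)\<close>
    by (subst kth_smallest_eq_iff) (auto simp: filter_mset_image_mset)
  then show ?thesis
    by (simp add: mem_solution_indices_iff otimes_def vec_eq_iff k_def)
qed

lemma solution_indices_cong_order:
  fixes A B :: "real ^ 'n ^ 'm"
  assumes "0 < \<omega>" "\<omega> \<le> 1"
    and less_iff: "\<And>i l j. A $ i $ j < A $ l $ j \<longleftrightarrow> B $ i $ j < B $ l $ j"
  shows "solution_indices A \<omega> = solution_indices B \<omega>"
proof -
  have "A $ i $ j \<le> A $ l $ j \<longleftrightarrow> B $ i $ j \<le> B $ l $ j" for i l j
    using less_iff[of l j i] by (simp add: linorder_not_less [symmetric])
  with less_iff show ?thesis
    by (auto simp: mem_solution_indices_iff_card[OF assms(1,2)])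
qed

text \<open>A column without repetitions has a strictly increasing enumeration, so each of its entries
  has exactly one rank, and comparing ranks amounts to comparing positions in this enumeration.\<close>

lemma principal_order_matrix_less_iff:
  fixes A :: "real ^ 'n ^ 'm"
  assumes "column_distinct A"
  shows "A $ i $ j < A $ l $ j \<longleftrightarrow>
    principal_order_matrix A $ i $ j < principal_order_matrix A $ l $ j"
proof -
  define S where "S = {# A $ l $ j. l \<in># mset_set UNIV #}"
  define xs where "xs = sorted_list_of_multiset S"
  have inj: "inj (\<lambda>l. A $ l $ j)" using assms by (simp add: column_distinct_def)
  have xs: "mset xs = S" by (simp add: xs_def)
  then have len: "length xs = CARD('m)" by (metis S_def size_image_mset size_mset size_mset_set)
  have set: "set xs = range (\<lambda>l. A $ l $ j)"
    by (metis S_def finite finite_set_mset_mset_set set_image_mset set_mset_mset xs)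
  have "distinct xs"
    using len set inj by (metis card_distinct card_image)
  then have strict: "sorted_wrt (<) xs"
    by (simp add: strict_sorted_iff xs_def)
  have nth_less: "xs ! p < xs ! q \<longleftrightarrow> p < q" if "p < length xs" "q < length xs" for p q
    using that sorted_wrt_nth_less[OF strict, of p q] sorted_wrt_nth_less[OF strict, of q p]
    by (cases p q rule: linorder_cases) auto
  define r where "r i = (THE k. k \<in> {1..CARD('m)} \<and> A $ i $ j = kth_smallest k S)" for i
  have r: "r i \<in> {1..CARD('m)}" "A $ i $ j = xs ! (r i - 1)" for i
  proof -
    obtain p where p: "p < length xs" "xs ! p = A $ i $ j"
      using set by (metis in_set_conv_nth rangeI)
    have "\<exists>!k. k \<in> {1..CARD('m)} \<and> A $ i $ j = kth_smallest k S"
    proof (rule ex1I[of _ "Suc p"])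
      show "Suc p \<in> {1..CARD('m)} \<and> A $ i $ j = kth_smallest (Suc p) S"
        using p len by (simp add: kth_smallest_def xs_def)
    next
      fix k assume "k \<in> {1..CARD('m)} \<and> A $ i $ j = kth_smallest k S"
      then have "k \<ge> 1" "k - 1 < length xs" "xs ! (k - 1) = xs ! p"
        using p len by (auto simp: kth_smallest_def xs_def)
      with p(1) \<open>distinct xs\<close> show "k = Suc p" by (auto simp: nth_eq_iff_index_eq)
    qed
    from theI'[OF this, folded r_def]
    show "r i \<in> {1..CARD('m)}" "A $ i $ j = xs ! (r i - 1)"
      by (auto simp: kth_smallest_def xs_def)
  qed
  have "A $ i $ j < A $ l $ j \<longleftrightarrow> r i - 1 < r l - 1"
    unfolding r(2)[of i] r(2)[of l]
    by (rule nth_less) (use r(1)[of i] r(1)[of l] len in auto)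
  also have "\<dots> \<longleftrightarrow> r i < r l" using r(1)[of i] r(1)[of l] by auto
  finally show ?thesis by (simp add: principal_order_matrix_def r_def S_def)
qed

theorem proposition3p3:
  fixes A :: "real ^ 'n ^ 'm"
  assumes "column_distinct A"
  shows "\<forall>\<omega>. 0 < \<omega> \<and> \<omega> \<le> 1 \<longrightarrow>
    solution_indices A \<omega> = solution_indices (principal_order_matrix A) \<omega>"
  using solution_indices_cong_order principal_order_matrix_less_iff[OF assms] by blast

end
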